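(* Let $P^*$ be the ground truth distribution and let $P_1,\dots,P_n$ be the vendors' distributions, $P_i=(1-\varepsilon_i)P^*+\varepsilon_iQ_i$ with $\varepsilon_i\in[0,1)$ and $Q_i$ probability distributions. Let $\pi_1,\dots,\pi_{n!}$ be a fixed ordering of all permutations of $\{1,\dots,n\}$, and consider the two-player zero-sum game in which the row player picks $r\in\{1,\dots,n\}$, the column player picks a permutation $\pi_c$, $c\in\{1,\dots,n!\}$, and the row player's payoff is $\mathcal R_{r,c}=-d(P^*,P_{\pi_c[r]})$, where $d$ is the MMD and $\pi_c[r]$ is the entry of $\pi_c$ at position $r$. Then the optimal solution for the row player to $$\max_r\min_c\mathcal R_{r,c}$$ is $s^*_{\mathrm{row}}=[\frac1n,\frac1n,\dots,\frac1n]$.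
   Context: A strategy (solution) for the row player is a probability vector $s_{\mathrm{row}}=(s_1,\dots,s_n)$, where $s_r$ is the probability with which the row player picks position $r$. Optimality of a row strategy in $\max_r\min_c\mathcal R_{r,c}$ is meant over such mixed strategies: an optimal $s_{\mathrm{row}}$ solves the linear program of maximizing $z$ subject to $\sum_{r=1}^ns_r\mathcal R_{r,c}\ge z$ for every $c\in\{1,\dots,n!\}$, $\sum_{r=1}^ns_r=1$, and $s_r\ge0$ for all $r$. All distributions are probability distributions on a common space. $k$ is a fixed kernel function with $k(x,x')\le K$ for all $x,x'$, and $\mathcal F$ is the class of functions in the unit ball of the reproducing kernel Hilbert space associated with $k$. The maximum mean discrepancy (MMD) is $d(P,P')=\sup_{f\in\mathcal F}\big(\mathbb E_{X\sim P}f(X)-\mathbb E_{W\sim P'}f(W)\big)$.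
   Formalization: The uniform strategy is shown optimal in all cases; that it is the only optimal strategy is shown when the distances d(P*,P_i) are not all equal, since if they all coincide (e.g. all ε_i=0, n≥2) every strategy is optimal. *)

theory Defs
  imports "HOL-Probability.Probability" "HOL-Combinatorics.Permutations"
begin

definition pd_kernel :: "'a set \<Rightarrow> ('a \<Rightarrow> 'a \<Rightarrow> real) \<Rightarrow> bool" where
  "pd_kernel X k \<longleftrightarrow>
     (\<forall>x\<in>X. \<forall>y\<in>X. k x y = k y x) \<and>
     (\<forall>A c. finite A \<and> A \<subseteq> X \<longrightarrow> 0 \<le> (\<Sum>x\<in>A. \<Sum>y\<in>A. c x * c y * k x y))"

text \<open>
  Real-valued functions on \<open>X\<close> are represented by functions on the whole type that vanish
  outside \<open>X\<close>, so that two of them agree on \<open>X\<close> iff they are equal.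
\<close>

definition kernel_section :: "'a set \<Rightarrow> ('a \<Rightarrow> 'a \<Rightarrow> real) \<Rightarrow> 'a \<Rightarrow> 'a \<Rightarrow> real" where
  "kernel_section X k x = (\<lambda>y. if y \<in> X then k x y else 0)"

text \<open>
  \<open>H\<close> with inner product \<open>ip\<close> is the reproducing kernel Hilbert space on \<open>X\<close> associated with
  \<open>k\<close>. By the Moore--Aronszajn theorem such a pair exists for every positive semidefinite
  kernel, and \<open>H\<close> and the values of \<open>ip\<close> on \<open>H\<close> are determined by \<open>X\<close> and \<open>k\<close>.
\<close>

locale rkhs =
  fixes X :: "'a set"
    and k :: "'a \<Rightarrow> 'a \<Rightarrow> real"
    and H :: "('a \<Rightarrow> real) set"
    and ip :: "('a \<Rightarrow> real) \<Rightarrow> ('a \<Rightarrow> real) \<Rightarrow> real"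
  assumes vanish: "\<lbrakk>f \<in> H; x \<notin> X\<rbrakk> \<Longrightarrow> f x = 0"
    and zero_mem: "(\<lambda>x. 0) \<in> H"
    and add_mem: "\<lbrakk>f \<in> H; g \<in> H\<rbrakk> \<Longrightarrow> (\<lambda>x. f x + g x) \<in> H"
    and scale_mem: "f \<in> H \<Longrightarrow> (\<lambda>x. a * f x) \<in> H"
    and ip_commute: "\<lbrakk>f \<in> H; g \<in> H\<rbrakk> \<Longrightarrow> ip f g = ip g f"
    and ip_add: "\<lbrakk>f \<in> H; g \<in> H; h \<in> H\<rbrakk> \<Longrightarrow> ip (\<lambda>x. f x + g x) h = ip f h + ip g h"
    and ip_scale: "\<lbrakk>f \<in> H; g \<in> H\<rbrakk> \<Longrightarrow> ip (\<lambda>x. a * f x) g = a * ip f g"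
    and ip_nonneg: "f \<in> H \<Longrightarrow> 0 \<le> ip f f"
    and ip_definite: "\<lbrakk>f \<in> H; ip f f = 0\<rbrakk> \<Longrightarrow> f = (\<lambda>x. 0)"
    and complete: "Metric_space.mcomplete H
                     (\<lambda>f g. sqrt (ip (\<lambda>x. f x - g x) (\<lambda>x. f x - g x)))"
    and section_mem: "x \<in> X \<Longrightarrow> kernel_section X k x \<in> H"
    and reproducing: "\<lbrakk>f \<in> H; x \<in> X\<rbrakk> \<Longrightarrow> ip f (kernel_section X k x) = f x"

definition unit_ball ::
    "('a \<Rightarrow> real) set \<Rightarrow> (('a \<Rightarrow> real) \<Rightarrow> ('a \<Rightarrow> real) \<Rightarrow> real) \<Rightarrow> ('a \<Rightarrow> real) set" where
  "unit_ball H ip = {f \<in> H. sqrt (ip f f) \<le> 1}"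

text \<open>
  The supremum is taken in the reals. When \<open>F\<close> is the unit ball of the RKHS of a measurable
  kernel bounded above by \<open>K\<close>, every \<open>f \<in> F\<close> satisfies \<open>\<bar>f x\<bar> \<le> sqrt K\<close> and is measurable,
  so the integrals exist and the set of differences is nonempty and bounded.
\<close>

definition mmd :: "('a \<Rightarrow> real) set \<Rightarrow> 'a measure \<Rightarrow> 'a measure \<Rightarrow> real" where
  "mmd F P P' = (SUP f\<in>F. (\<integral>x. f x \<partial>P) - (\<integral>w. f w \<partial>P'))"

text \<open>
  A matrix game with payoffs \<open>R r c\<close> to the row player, \<open>r \<in> {1..n}\<close>, \<open>c \<in> {1..m}\<close>; only the
  values of a strategy \<open>s\<close> on \<open>{1..n}\<close> matter.
\<close>

definition row_lp_feasible ::
    "nat \<Rightarrow> nat \<Rightarrow> (nat \<Rightarrow> nat \<Rightarrow> real) \<Rightarrow> (nat \<Rightarrow> real) \<Rightarrow> real \<Rightarrow> bool" where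
  "row_lp_feasible n m R s z \<longleftrightarrow>
     (\<forall>c\<in>{1..m}. (\<Sum>r=1..n. s r * R r c) \<ge> z) \<and>
     (\<Sum>r=1..n. s r) = 1 \<and>
     (\<forall>r\<in>{1..n}. s r \<ge> 0)"

definition optimal_row_strategy ::
    "nat \<Rightarrow> nat \<Rightarrow> (nat \<Rightarrow> nat \<Rightarrow> real) \<Rightarrow> (nat \<Rightarrow> real) \<Rightarrow> bool" where
  "optimal_row_strategy n m R s \<longleftrightarrow>
     (\<exists>z. row_lp_feasible n m R s z \<and> (\<forall>s' z'. row_lp_feasible n m R s' z' \<longrightarrow> z' \<le> z))"

end

theory Submission imports Defs begin

text \<open>
  Only the payoff vector \<open>a i = - d(P\<^sup>*, P\<^sub>i)\<close> matters. Averaging the column constraints of a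
  strategy \<open>s\<close> over all permutations shows that the value \<open>z\<close> is at most the mean of \<open>a\<close>,
  which the uniform strategy attains against every permutation. If \<open>s\<close> attains it too, then
  every constraint is tight, so composing a permutation \<open>p\<close> with the transposition of two
  positions \<open>r, r'\<close> gives \<open>(s r - s r') * (a (p r) - a (p r')) = 0\<close>; when \<open>a\<close> is not
  constant, \<open>p\<close> can be chosen to make the second factor nonzero.
\<close>

text \<open>Precomposing with the transposition of \<open>r\<close> and \<open>r'\<close> is an
  involution on the permutations of \<open>A\<close> that exchanges evaluation at \<open>r\<close>
  with evaluation at \<open>r'\<close>.\<close>

lemma sum_permutes_apply_eq:
  assumes "r \<in> A" "r' \<in> A"
  shows "(\<Sum>p | p permutes A. f (p r)) = (\<Sum>p | p permutes A. f (p r'))"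
proof -
  have "bij_betw (\<lambda>p. p \<circ> Transposition.transpose r r') {p. p permutes A} {p. p permutes A}"
    by (rule bij_betw_byWitness[where f' = "\<lambda>p. p \<circ> Transposition.transpose r r'"])
      (auto simp: comp_assoc intro: permutes_compose permutes_swap_id assms)
  from sum.reindex_bij_betw[OF this, of "\<lambda>p. f (p r')"] show ?thesis
    by simp
qed

lemma sum_permutes_weighted:
  fixes s a :: "'b \<Rightarrow> real"
  assumes "finite A" "sum s A = 1"
  shows "(\<Sum>p | p permutes A. \<Sum>r\<in>A. s r * a (p r)) = fact (card A) * (sum a A / card A)"
proof -
  from assms(2) have "A \<noteq> {}"
    by auto
  then obtain q where q: "q \<in> A"
    by blast
  define C where "C = (\<Sum>p | p permutes A. a (p q))"
  have C: "(\<Sum>p | p permutes A. a (p r)) = C" if "r \<in> A" for r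
    unfolding C_def using that q by (rule sum_permutes_apply_eq)
  \<comment> \<open>Kept general in \<open>w\<close>: constant weights 1 determine \<open>C\<close>,
    and the weights \<open>s\<close> then give the claim.\<close>
  have weighted: "(\<Sum>p | p permutes A. \<Sum>r\<in>A. w r * a (p r)) = sum w A * C" for w
    by (subst sum.swap) (simp add: sum_distrib_left[symmetric] sum_distrib_right C)
  \<comment> \<open>With weights 1, each permutation merely reorders the terms of
    \<open>sum a A\<close>.\<close>
  have "(\<Sum>p | p permutes A. \<Sum>r\<in>A. a (p r)) = (\<Sum>p | p permutes A. sum a A)"
    by (rule sum.cong[OF refl]) (simp add: sum.permute[of _ A a, unfolded comp_def, symmetric])
  also have "\<dots> = fact (card A) * sum a A"
    using assms(1) by (simp add: card_permutations)
  finally have "real (card A) * C = fact (card A) * sum a A"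
    using weighted[of "\<lambda>_. 1"] by simp
  moreover have "card A \<noteq> 0"
    using \<open>A \<noteq> {}\<close> assms(1) by simp
  ultimately have "C = fact (card A) * (sum a A / card A)"
    by (simp add: field_simps)
  with weighted[of s] assms(2) show ?thesis
    by simp
qed

lemma permutes_lower_bound_le_mean:
  fixes s a :: "'b \<Rightarrow> real"
  assumes "finite A" "sum s A = 1"
    and "\<And>p. p permutes A \<Longrightarrow> z \<le> (\<Sum>r\<in>A. s r * a (p r))"
  shows "z \<le> sum a A / card A"
proof -
  have "fact (card A) * z = (\<Sum>p | p permutes A. z)"
    using assms(1) by (simp add: card_permutations)
  also have "\<dots> \<le> (\<Sum>p | p permutes A. \<Sum>r\<in>A. s r * a (p r))"
    by (intro sum_mono assms(3)) simp
  also have "\<dots> = fact (card A) * (sum a A / card A)"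
    using assms(1,2) by (rule sum_permutes_weighted)
  finally show ?thesis
    by (simp only: mult_le_cancel_left_pos fact_gt_zero)
qed

text \<open>Summed over all permutations, the two sides of \<open>ge\<close> agree, so no single
  inequality can be strict.\<close>

lemma permutes_all_ge_mean_imp_eq:
  fixes s a :: "'b \<Rightarrow> real"
  assumes "finite A" "sum s A = 1"
    and ge: "\<And>p. p permutes A \<Longrightarrow> sum a A / card A \<le> (\<Sum>r\<in>A. s r * a (p r))"
    and p: "p permutes A"
  shows "(\<Sum>r\<in>A. s r * a (p r)) = sum a A / card A"
proof -
  have "(\<Sum>q | q permutes A. sum a A / card A) = (\<Sum>q | q permutes A. \<Sum>r\<in>A. s r * a (q r))"
    using assms(1,2) by (simp add: sum_permutes_weighted card_permutations)
  from sum_mono_inv[OF this, of p] show ?thesis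
    using ge p assms(1) by (simp add: finite_permutations)
qed

lemma permutes_all_eq_imp_weights_eq:
  fixes s a :: "'b \<Rightarrow> real"
  assumes "finite A"
    and eq: "\<And>p. p permutes A \<Longrightarrow> (\<Sum>r\<in>A. s r * a (p r)) = v"
    and ij: "i \<in> A" "j \<in> A" "a i \<noteq> a j"
    and r: "r \<in> A" "r' \<in> A"
  shows "s r = s r'"
proof (cases "r = r'")
  case False
  \<comment> \<open>The aim is a permutation with \<open>p r = i\<close> and
    \<open>p r' = j\<close>. Swapping \<open>r\<close> and \<open>i\<close> sends \<open>r\<close>
    to \<open>i\<close> and \<open>r'\<close> to \<open>t\<close>; swapping \<open>t\<close> and
    \<open>j\<close> then sends \<open>t\<close> to \<open>j\<close> and fixes \<open>i\<close>,
    which differs from both.\<close>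
  define t where "t = Transposition.transpose r i r'"
  define p where "p = Transposition.transpose t j \<circ> Transposition.transpose r i"
  have t: "t \<in> A" "t \<noteq> i"
    using False r ij by (auto simp: t_def Transposition.transpose_def)
  have p: "p permutes A"
    unfolding p_def using t r ij by (intro permutes_compose permutes_swap_id)
  have pr: "p r = i" "p r' = j"
    using t ij by (auto simp: p_def t_def[symmetric]) (auto simp: Transposition.transpose_def)
  have split: "(\<Sum>x\<in>A. f x) = f r + f r' + (\<Sum>x\<in>A - {r, r'}. f x)" for f :: "'b \<Rightarrow> real"
    using sum.subset_diff[of "{r, r'}" A f] assms(1) r False by (simp add: algebra_simps)
  \<comment> \<open>Composing with the transposition changes \<open>p\<close> only at
    \<open>r\<close> and \<open>r'\<close>. Since both permutations yield \<open>v\<close>, the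
    common terms cancel and only these two positions remain.\<close>
  have "(\<Sum>x\<in>A - {r, r'}. s x * a ((p \<circ> Transposition.transpose r r') x)) =
      (\<Sum>x\<in>A - {r, r'}. s x * a (p x))"
    by (intro sum.cong) (auto simp: Transposition.transpose_def)
  moreover have "(\<Sum>x\<in>A. s x * a ((p \<circ> Transposition.transpose r r') x)) =
      (\<Sum>x\<in>A. s x * a (p x))"
    using eq p r by (simp add: permutes_compose permutes_swap_id del: comp_apply)
  ultimately have "s r * a j + s r' * a i = s r * a i + s r' * a j"
    by (simp add: split pr)
  then have "(s r - s r') * (a i - a j) = 0"
    by (simp add: algebra_simps)
  with ij show ?thesis
    by simp
qed simp

text \<open>As \<open>\<pi>\<close> hits every permutation, the column constraints can be indexed by
  permutations themselves, which makes the averaging and swapping arguments applicable.\<close>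

lemma row_lp_feasible_permutation_game:
  assumes ordering: "bij_betw \<pi> {1..m} {p. p permutes {1..n}}"
    and R: "\<And>r c. \<lbrakk>r \<in> {1..n}; c \<in> {1..m}\<rbrakk> \<Longrightarrow> R r c = a (\<pi> c r)"
  shows "row_lp_feasible n m R s z \<longleftrightarrow>
    (\<forall>p. p permutes {1..n} \<longrightarrow> z \<le> (\<Sum>r\<in>{1..n}. s r * a (p r))) \<and>
    sum s {1..n} = 1 \<and> (\<forall>r\<in>{1..n}. s r \<ge> 0)"
proof -
  have "(\<Sum>r\<in>{1..n}. s r * R r c) = (\<Sum>r\<in>{1..n}. s r * a (\<pi> c r))" if "c \<in> {1..m}" for c
    using R that by (intro sum.cong) auto
  then have "(\<forall>c\<in>{1..m}. z \<le> (\<Sum>r\<in>{1..n}. s r * R r c)) \<longleftrightarrow>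
      (\<forall>p\<in>\<pi> ` {1..m}. z \<le> (\<Sum>r\<in>{1..n}. s r * a (p r)))"
    by simp
  then show ?thesis
    unfolding row_lp_feasible_def bij_betw_imp_surj_on[OF ordering] by simp
qed

text \<open>Uniqueness is conditional: if all the distances coincide, every mixed strategy earns the
  same payoff against every column and is therefore optimal.\<close>

theorem proposition3:
  fixes M Pstar :: "'a measure"
    and P Q :: "nat \<Rightarrow> 'a measure"
    and \<epsilon> :: "nat \<Rightarrow> real"
    and k :: "'a \<Rightarrow> 'a \<Rightarrow> real"
    and K :: real
    and H :: "('a \<Rightarrow> real) set"
    and ip :: "('a \<Rightarrow> real) \<Rightarrow> ('a \<Rightarrow> real) \<Rightarrow> real"
    and n :: nat
    and \<pi> :: "nat \<Rightarrow> nat \<Rightarrow> nat"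
    and R :: "nat \<Rightarrow> nat \<Rightarrow> real"
  assumes n: "n \<ge> 1"
    and kernel: "pd_kernel (space M) k"
    and kernel_measurable: "\<And>x. x \<in> space M \<Longrightarrow> k x \<in> borel_measurable M"
    and kernel_bound: "\<And>x x'. \<lbrakk>x \<in> space M; x' \<in> space M\<rbrakk> \<Longrightarrow> k x x' \<le> K"
    and rkhs: "rkhs (space M) k H ip"
    and Pstar: "prob_space Pstar" "sets Pstar = sets M"
    and Q: "\<And>i. i \<in> {1..n} \<Longrightarrow> prob_space (Q i)" "\<And>i. i \<in> {1..n} \<Longrightarrow> sets (Q i) = sets M"
    and P: "\<And>i. i \<in> {1..n} \<Longrightarrow> prob_space (P i)" "\<And>i. i \<in> {1..n} \<Longrightarrow> sets (P i) = sets M"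
    and eps: "\<And>i. i \<in> {1..n} \<Longrightarrow> 0 \<le> \<epsilon> i \<and> \<epsilon> i < 1"
    and mixture: "\<And>i A. \<lbrakk>i \<in> {1..n}; A \<in> sets M\<rbrakk> \<Longrightarrow>
          measure (P i) A = (1 - \<epsilon> i) * measure Pstar A + \<epsilon> i * measure (Q i) A"
    and ordering: "bij_betw \<pi> {1..fact n} {p. p permutes {1..n}}"
    and payoff: "\<And>r c. \<lbrakk>r \<in> {1..n}; c \<in> {1..fact n}\<rbrakk> \<Longrightarrow>
          R r c = - mmd (unit_ball H ip) Pstar (P (\<pi> c r))"
  shows "optimal_row_strategy n (fact n) R (\<lambda>r. 1 / real n) \<and>
         ((\<exists>i\<in>{1..n}. \<exists>j\<in>{1..n}.
             mmd (unit_ball H ip) Pstar (P i) \<noteq> mmd (unit_ball H ip) Pstar (P j)) \<longrightarrow>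
          (\<forall>s. optimal_row_strategy n (fact n) R s \<longrightarrow> (\<forall>r\<in>{1..n}. s r = 1 / real n)))"
proof -
  define a where "a i = - mmd (unit_ball H ip) Pstar (P i)" for i
  define v where "v = sum a {1..n} / card {1..n}"
  have feasible: "row_lp_feasible n (fact n) R s z \<longleftrightarrow>
      (\<forall>p. p permutes {1..n} \<longrightarrow> z \<le> (\<Sum>r\<in>{1..n}. s r * a (p r))) \<and>
      sum s {1..n} = 1 \<and> (\<forall>r\<in>{1..n}. s r \<ge> 0)" for s z
    using ordering by (rule row_lp_feasible_permutation_game) (simp add: payoff a_def)
  have upper: "z \<le> v" if "row_lp_feasible n (fact n) R s z" for s z
    unfolding v_def using that permutes_lower_bound_le_mean[of "{1..n}" s z a]
    by (simp add: feasible)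
  \<comment> \<open>Equal weights make the payoff blind to the order of the vendors.\<close>
  have uniform_payoff: "(\<Sum>r\<in>{1..n}. 1 / real n * a (p r)) = v" if "p permutes {1..n}" for p
    unfolding sum_distrib_left[symmetric]
    using sum.permute[OF that, of a] by (simp add: v_def comp_def)
  have uniform: "row_lp_feasible n (fact n) R (\<lambda>r. 1 / real n) v"
    unfolding feasible using uniform_payoff n by auto
  have "s r = 1 / real n"
    if ij: "i \<in> {1..n}" "j \<in> {1..n}" "a i \<noteq> a j"
      and opt: "optimal_row_strategy n (fact n) R s" and r: "r \<in> {1..n}" for i j s r
  proof -
    \<comment> \<open>The optimal value of \<open>s\<close> is at least \<open>v\<close> because the
      uniform strategy is a feasible competitor with value \<open>v\<close>.\<close>
    from opt uniform obtain z where z: "row_lp_feasible n (fact n) R s z" "v \<le> z"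
      unfolding optimal_row_strategy_def by blast
    then have sum: "sum s {1..n} = 1"
      by (simp add: feasible)
    have ge: "sum a {1..n} / card {1..n} \<le> (\<Sum>r\<in>{1..n}. s r * a (p r))"
      if "p permutes {1..n}" for p
      using z that unfolding feasible v_def[symmetric] by force
    have tight: "(\<Sum>r\<in>{1..n}. s r * a (p r)) = v" if "p permutes {1..n}" for p
      unfolding v_def using sum ge that by (intro permutes_all_ge_mean_imp_eq) auto
    have "s r' = s r" if "r' \<in> {1..n}" for r'
      using tight ij that r by (intro permutes_all_eq_imp_weights_eq[of "{1..n}" s a v i j]) auto
    then have "sum s {1..n} = (\<Sum>r'\<in>{1..n}. s r)"
      by (intro sum.cong) auto
    with sum n show ?thesis
      by (simp add: field_simps)
  qed
  moreover have "optimal_row_strategy n (fact n) R (\<lambda>r. 1 / real n)"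
    unfolding optimal_row_strategy_def using uniform upper by blast
  ultimately show ?thesis
    unfolding a_def neg_equal_iff_equal by blast
qed

end
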